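(* Let $\mathcal{L}:\mathbb{R}^{d_x}\times\mathbb{R}^{d_y}\to\mathbb{R}$ be differentiable, let $\mathcal{X}\subset\mathbb{R}^{d_x}$ and $\mathcal{Y}\subset\mathbb{R}^{d_y}$ be closed sets, let $(x_0,y_0)\in\mathcal{X}\times\mathcal{Y}$, $\rho_x,\rho_y>0$, $\mathcal{X}_0=\mathcal{X}\cap\mathbb{B}_2(x_0,\rho_x)$, $\mathcal{Y}_0=\mathcal{Y}\cap\mathbb{B}_2(y_0,\rho_y)$, and let $(\widehat{x},\widehat{y})=\arg\min\{\mathcal{L}(x,y):x\in\mathcal{X}_0,y\in\mathcal{Y}_0\}$. Suppose that there are constants $0<\alpha_x\le\beta_x$, $0<\alpha_y\le\beta_y$, $0\le\mu_x\le\alpha_x$, $0\le\mu_y\le\alpha_y$, $\epsilon_x,\epsilon_y\ge0$ such that the following five assumptions (stated in full in the context) hold: joint restricted strong convexity, restricted smoothness, the cross-product bound, the initialization condition, and the relaxed triangle inequality. Let $(x_t,y_t)_{t\ge1}$ be generated by the inexact alternating minimization algorithm with tolerances $\delta_t^x,\delta_t^y\ge 0$: for all $t\ge1$, $$x_t^{\mathrm{exact}}=\arg\min_{x\in\mathcal{X}_0}\mathcal{L}(x,y_{t-1}),\quad x_t\in\mathcal{X}_0\cap\mathbb{B}_2(x_t^{\mathrm{exact}},\delta_t^x),$$ $$y_t^{\mathrm{exact}}=\arg\min_{y\in\mathcal{Y}_0}\mathcal{L}(x_t,y),\quad y_t\in\mathcal{Y}_0\cap\mathbb{B}_2(y_t^{\mathrm{exact}},\delta_t^y).$$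 Suppose that for some $c_x,c_y\ge0$ and $0\le C_x,C_y<\infty$, for all $t\ge1$, $$\delta_t^x\le c_x\|x_{t-1}-x_t^{\mathrm{exact}}\|_2+C_x\epsilon_x,\qquad\delta_t^y\le c_y\|y_{t-1}-y_t^{\mathrm{exact}}\|_2+C_y\epsilon_y.$$ If $$r:=\left(\sqrt{1-\frac{\alpha_x}{2\beta_x}}+3c_y\sqrt{\frac{\beta_y}{\alpha_y}}\right)\cdot\left(\sqrt{1-\frac{\alpha_y}{2\beta_y}}+3c_x\sqrt{\frac{\beta_x}{\alpha_x}}\right)<1,$$ then for all $t\ge1$, $$\|(x_t,y_t)-(\widehat{x},\widehat{y})\|_2\le r^t\cdot\frac{\sqrt{6(\alpha_x\rho_x^2+\beta_y\rho_y^2)}}{\sqrt{\min\{\alpha_x,\alpha_y\}}}+C\cdot\max\{\epsilon_x,\epsilon_y\},$$ where $$C=\frac{39}{1-r}\cdot\sqrt{\frac{\alpha_x+\alpha_y+C_x^2\beta_x+C_y^2\beta_y}{\min\{\alpha_x,\alpha_y\}}}.$$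
   Context: **Notation.** $\mathbb{B}_2(z,\rho)$ is the closed Euclidean ball of center $z$ and radius $\rho$. All argmins are assumed to exist; if an argmin is not unique, it denotes a chosen minimizer (the same choice in the algorithm and in the initialization condition). $\|\cdot\|_x$ and $\|\cdot\|_y$ are fixed norms on $\mathbb{R}^{d_x}$ and $\mathbb{R}^{d_y}$ satisfying $\|\cdot\|_x\ge\|\cdot\|_2$, $\|\cdot\|_y\ge\|\cdot\|_2$; $\|\cdot\|_x^*$, $\|\cdot\|_y^*$ are their dual norms. **Local concavity coefficients.** Let $\mathcal{Z}\subset\mathbb{R}^d$ be closed and $\|\cdot\|$ a norm on $\mathbb{R}^d$. $\mathcal{Z}$ satisfies the curvature condition at $z\in\mathcal{Z}$ with parameter $\gamma_z\in[0,\infty]$ if for all $z'\in\mathcal{Z}$, $\limsup_{t\to0^+}\frac{\min_{w\in\mathcal{Z}}\|w-((1-t)z+tz')\|}{t}\le\gamma_z\|z-z'\|_2^2$. A point $z\in\mathcal{Z}$ is degenerate if the Euclidean projection $\mathcal{P}_{\mathcal{Z}}$ onto $\mathcal{Z}$ is not continuous in any neighborhood of $z$. The local concavity coefficient $\gamma_z(\mathcal{Z})$ is $\infty$ if $z$ is degenerate, and otherwise the smallest $\gamma_z\in[0,\infty]$ such that the curvature condition holds at $z$. The global coefficient is $\gamma(\mathcal{Z})=\sup_{z\in\mathcal{Z}}\gamma_z(\mathcal{Z})$. Here $\gamma(\mathcal{X}_0)$ is taken with respect to $\|\cdot\|_x$ and $\gamma(\mathcal{Y}_0)$ with respect to $\|\cdot\|_y$.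 **First-order divergence.** $D^2(x;\widehat{x})=\langle x-\widehat{x},\nabla_x\mathcal{L}(x,\widehat{y})-\nabla_x\mathcal{L}(\widehat{x},\widehat{y})\rangle$ and $D^2(y;\widehat{y})=\langle y-\widehat{y},\nabla_y\mathcal{L}(\widehat{x},y)-\nabla_y\mathcal{L}(\widehat{x},\widehat{y})\rangle$ (these may be negative); $D(x;\widehat{x})=\sqrt{\max\{0,D^2(x;\widehat{x})\}}$, $D(y;\widehat{y})=\sqrt{\max\{0,D^2(y;\widehat{y})\}}$. **Joint restricted strong convexity.** For all $x\in\mathcal{X}_0$, $y\in\mathcal{Y}_0$: $\left\langle\begin{pmatrix}x-\widehat{x}\\ y-\widehat{y}\end{pmatrix},\nabla\mathcal{L}(x,y)-\nabla\mathcal{L}(\widehat{x},\widehat{y})\right\rangle\ge\alpha_x\|x-\widehat{x}\|_2^2+\alpha_y\|y-\widehat{y}\|_2^2-\alpha_x\epsilon_x^2-\alpha_y\epsilon_y^2$. **Restricted smoothness.** For all $x\in\mathcal{X}_0$, $y\in\mathcal{Y}_0$: $D^2(x;\widehat{x})\le\beta_x\|x-\widehat{x}\|_2^2+\alpha_x\epsilon_x^2$ and $D^2(y;\widehat{y})\le\beta_y\|y-\widehat{y}\|_2^2+\alpha_y\epsilon_y^2$. **Cross-product bound.** For all $x\in\mathcal{X}_0$, $y\in\mathcal{Y}_0$: $\left|\langle x-\widehat{x},\nabla_x\mathcal{L}(x,y)-\nabla_x\mathcal{L}(x,\widehat{y})\rangle-\langle y-\widehat{y},\nabla_y\mathcal{L}(x,y)-\nabla_y\mathcal{L}(\widehat{x},y)\rangle\right|\le\frac12\mu_x\|x-\widehat{x}\|_2^2+\frac12\mu_y\|y-\widehat{y}\|_2^2+\alpha_x\epsilon_x^2+\alpha_y\epsilon_y^2$.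 **Initialization condition.** With $x_y=\arg\min\{\mathcal{L}(x,y):x\in\mathcal{X}_0\}$ for $y\in\mathcal{Y}_0$ and $y_x=\arg\min\{\mathcal{L}(x,y):y\in\mathcal{Y}_0\}$ for $x\in\mathcal{X}_0$: $2\gamma(\mathcal{X}_0)\left(\|\nabla_x\mathcal{L}(\widehat{x},\widehat{y})\|_x^*+\max_{y\in\mathcal{Y}_0}\|\nabla_x\mathcal{L}(x_y,y)\|_x^*\right)\le\alpha_x-\mu_x$ and $2\gamma(\mathcal{Y}_0)\left(\|\nabla_y\mathcal{L}(\widehat{x},\widehat{y})\|_y^*+\max_{x\in\mathcal{X}_0}\|\nabla_y\mathcal{L}(x,y_x)\|_y^*\right)\le\alpha_y-\mu_y$. **Relaxed triangle inequality.** For all $x,x'\in\mathcal{X}_0$: $D(x;\widehat{x})\le D(x';\widehat{x})+\sqrt{\beta_x}\|x-x'\|_2+\sqrt{\alpha_x}\,\epsilon_x$; and for all $y,y'\in\mathcal{Y}_0$: $D(y;\widehat{y})\le D(y';\widehat{y})+\sqrt{\beta_y}\|y-y'\|_2+\sqrt{\alpha_y}\,\epsilon_y$. *)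

theory Defs
  imports "HOL-Analysis.Analysis"
begin

definition gradient :: "('a::real_inner \<Rightarrow> real) \<Rightarrow> 'a \<Rightarrow> 'a" where
  "gradient f x = (THE g. GDERIV f x :> g)"

lemma gderiv_unique:
  assumes "GDERIV f x :> g" and "GDERIV f x :> g'"
  shows "g = g'"
proof -
  have "(\<lambda>h. h \<bullet> g) = (\<lambda>h. h \<bullet> g')"
    using assms unfolding gderiv_def by (rule has_derivative_unique)
  then have "(g - g') \<bullet> g = (g - g') \<bullet> g'"
    by (rule fun_cong)
  then have "(g - g') \<bullet> (g - g') = 0"
    by (simp only: inner_diff_right)
  then show ?thesis
    by simp
qed

lemma gderiv_gradient:
  fixes f :: "'a::euclidean_space \<Rightarrow> real"
  assumes "f differentiable (at x)"
  shows "GDERIV f x :> gradient f x"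
proof -
  obtain f' where f': "(f has_derivative f') (at x)"
    using assms unfolding differentiable_def by blast
  interpret f': bounded_linear f'
    using f' by (rule has_derivative_bounded_linear)
  have "f' h = h \<bullet> (\<Sum>b\<in>Basis. f' b *\<^sub>R b)" for h
  proof -
    have "f' h = f' (\<Sum>b\<in>Basis. (h \<bullet> b) *\<^sub>R b)"
      by (simp add: euclidean_representation)
    also have "\<dots> = (\<Sum>b\<in>Basis. (h \<bullet> b) * f' b)"
      by (simp add: f'.sum f'.scaleR)
    finally show ?thesis
      by (simp add: inner_sum_right mult.commute)
  qed
  then have "f' = (\<lambda>h. h \<bullet> (\<Sum>b\<in>Basis. f' b *\<^sub>R b))"
    by (rule ext)
  with f' have "GDERIV f x :> (\<Sum>b\<in>Basis. f' b *\<^sub>R b)"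
    unfolding gderiv_def by simp
  then show ?thesis
    unfolding gradient_def by (rule theI) (erule gderiv_unique, fact)
qed

definition grad_x :: "('a::real_inner \<times> 'b::real_inner \<Rightarrow> real) \<Rightarrow> 'a \<Rightarrow> 'b \<Rightarrow> 'a" where
  "grad_x L x y = gradient (\<lambda>u. L (u, y)) x"

definition grad_y :: "('a::real_inner \<times> 'b::real_inner \<Rightarrow> real) \<Rightarrow> 'a \<Rightarrow> 'b \<Rightarrow> 'b" where
  "grad_y L x y = gradient (\<lambda>v. L (x, v)) y"

definition is_norm :: "('a::real_vector \<Rightarrow> real) \<Rightarrow> bool" where
  "is_norm N \<longleftrightarrow>
     (\<forall>v. N v = 0 \<longleftrightarrow> v = 0) \<and>
     (\<forall>a v. N (a *\<^sub>R v) = \<bar>a\<bar> * N v) \<and>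
     (\<forall>u v. N (u + v) \<le> N u + N v)"

definition dual_norm :: "('a::real_inner \<Rightarrow> real) \<Rightarrow> 'a \<Rightarrow> real" where
  "dual_norm N v = (SUP u\<in>{u. N u \<le> 1}. v \<bullet> u)"

text \<open>
  The minimal distance is written as an infimum over \<open>Z\<close>; for closed nonempty \<open>Z\<close> in a
  Euclidean space it is attained.
\<close>

definition curvature_cond ::
    "('a::euclidean_space \<Rightarrow> real) \<Rightarrow> 'a set \<Rightarrow> 'a \<Rightarrow> ennreal \<Rightarrow> bool" where
  "curvature_cond N Z z \<gamma> \<longleftrightarrow>
     (\<forall>z'\<in>Z.
        Limsup (at_right 0)
          (\<lambda>t::real. ennreal ((INF w\<in>Z. N (w - ((1 - t) *\<^sub>R z + t *\<^sub>R z'))) / t))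
        \<le> \<gamma> * ennreal ((norm (z - z'))\<^sup>2))"

text \<open>
  \<^const>\<open>closest_point\<close> chooses one of the nearest points. Degeneracy does not depend on the
  choice: a selection that is continuous on an open set witnesses that nearest points are unique
  there.
\<close>

definition degenerate :: "'a::euclidean_space set \<Rightarrow> 'a \<Rightarrow> bool" where
  "degenerate Z z \<longleftrightarrow> \<not> (\<exists>U. open U \<and> z \<in> U \<and> continuous_on U (closest_point Z))"

definition local_concavity ::
    "('a::euclidean_space \<Rightarrow> real) \<Rightarrow> 'a set \<Rightarrow> 'a \<Rightarrow> ennreal" where
  "local_concavity N Z z =
     (if degenerate Z z then \<infinity> else (LEAST \<gamma>. curvature_cond N Z z \<gamma>))"

text \<open>
  With values in \<^typ>\<open>ennreal\<close>, a product of this coefficient with gradient norms follows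
  the convention that zero times infinity is zero.
\<close>

definition concavity ::
    "('a::euclidean_space \<Rightarrow> real) \<Rightarrow> 'a set \<Rightarrow> ennreal" where
  "concavity N Z = (SUP z\<in>Z. local_concavity N Z z)"

definition Dsq_x ::
    "('a::real_inner \<times> 'b::real_inner \<Rightarrow> real) \<Rightarrow> 'a \<Rightarrow> 'b \<Rightarrow> 'a \<Rightarrow> real" where
  "Dsq_x L xh yh x = (x - xh) \<bullet> (grad_x L x yh - grad_x L xh yh)"

definition Dsq_y ::
    "('a::real_inner \<times> 'b::real_inner \<Rightarrow> real) \<Rightarrow> 'a \<Rightarrow> 'b \<Rightarrow> 'b \<Rightarrow> real" where
  "Dsq_y L xh yh y = (y - yh) \<bullet> (grad_y L xh y - grad_y L xh yh)"

definition D_x ::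
    "('a::real_inner \<times> 'b::real_inner \<Rightarrow> real) \<Rightarrow> 'a \<Rightarrow> 'b \<Rightarrow> 'a \<Rightarrow> real" where
  "D_x L xh yh x = sqrt (max 0 (Dsq_x L xh yh x))"

definition D_y ::
    "('a::real_inner \<times> 'b::real_inner \<Rightarrow> real) \<Rightarrow> 'a \<Rightarrow> 'b \<Rightarrow> 'b \<Rightarrow> real" where
  "D_y L xh yh y = sqrt (max 0 (Dsq_y L xh yh y))"

lemma curvature_cond_Inf:
  assumes N: "is_norm N" and z: "z \<in> Z"
  shows "curvature_cond N Z z (Inf {\<gamma>. curvature_cond N Z z \<gamma>})"
  unfolding curvature_cond_def[of N Z z "Inf _"]
proof
  fix z' assume z': "z' \<in> Z"
  define l where "l = Limsup (at_right 0)
    (\<lambda>t::real. ennreal ((INF w\<in>Z. N (w - ((1 - t) *\<^sub>R z + t *\<^sub>R z'))) / t))"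
  define c where "c = ennreal ((norm (z - z'))\<^sup>2)"
  let ?G = "{\<gamma>. curvature_cond N Z z \<gamma>}"
  have le: "l \<le> \<gamma> * c" if "\<gamma> \<in> ?G" for \<gamma>
    using that z' unfolding curvature_cond_def l_def c_def by blast
  show "l \<le> Inf ?G * c"
  proof (cases "z = z'")
    case True
    have N0: "N 0 = 0"
      using N unfolding is_norm_def by blast
    have "(1 - t) *\<^sub>R z + t *\<^sub>R z' = z" for t :: real
      using True by (simp add: algebra_simps)
    moreover have nonneg: "0 \<le> N v" for v
    proof -
      have "N (v + (-1) *\<^sub>R v) \<le> N v + N ((-1) *\<^sub>R v)"
        using N unfolding is_norm_def by blast
      moreover have "N ((-1) *\<^sub>R v) = \<bar>-1\<bar> * N v"
        using N unfolding is_norm_def by blast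
      ultimately show ?thesis
        using N0 by simp
    qed
    moreover have "(INF w\<in>Z. N (w - z)) = 0"
    proof (rule antisym)
      have "bdd_below ((\<lambda>w. N (w - z)) ` Z)"
        using nonneg by (intro bdd_belowI2[of _ 0]) simp
      then have "(INF w\<in>Z. N (w - z)) \<le> N (z - z)"
        using z by (rule cINF_lower)
      then show "(INF w\<in>Z. N (w - z)) \<le> 0"
        using N0 by simp
      show "0 \<le> (INF w\<in>Z. N (w - z))"
        using z nonneg by (intro cINF_greatest) auto
    qed
    ultimately have "l = 0"
      unfolding l_def by (simp add: Limsup_const)
    then show ?thesis by simp
  next
    case False
    then have c: "c \<noteq> 0" "c \<noteq> top"
      unfolding c_def by simp_all
    have "l / c \<le> Inf ?G"
    proof (rule Inf_greatest)
      fix \<gamma> assume "\<gamma> \<in> ?G"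
      then have "l / c \<le> \<gamma> * c / c"
        using le by (intro divide_right_mono_ennreal) auto
      also have "\<dots> = \<gamma>"
        using c by (simp add: ennreal_mult_divide_eq)
      finally show "l / c \<le> \<gamma>" .
    qed
    then have "l / c * c \<le> Inf ?G * c"
      by (rule mult_right_mono) simp
    then show ?thesis
      using c by (simp add: ennreal_divide_times ennreal_divide_self top.not_eq_extremum)
  qed
qed

lemma curvature_cond_Least:
  assumes "is_norm N" and "z \<in> Z"
  shows "curvature_cond N Z z (LEAST \<gamma>. curvature_cond N Z z \<gamma>)"
proof -
  have "(LEAST \<gamma>. curvature_cond N Z z \<gamma>) = Inf {\<gamma>. curvature_cond N Z z \<gamma>}"
    by (rule Least_equality) (auto intro: Inf_lower curvature_cond_Inf[OF assms])
  then show ?thesis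
    using curvature_cond_Inf[OF assms] by simp
qed

end

theory Submission
  imports Defs
begin

text \<open>
  At a minimizer over a set with finite concavity coefficient, the curvature condition gives a
  first-order optimality inequality with a quadratic error. Applied to \<open>xh\<close> and to an exact
  half step \<open>xmin v\<close>, the initialization condition turns the two errors into
  \<open>(\<alpha>x - \<mu>x) / 2 * (norm (xmin v - xh))\<^sup>2\<close>; combined with joint strong convexity, the
  cross-product bound and smoothness this shows that an exact half step contracts the divergence,
  \<open>D (xmin v) \<le> qx * D v\<close> up to noise, with \<open>qx = sqrt (1 - \<alpha>y / (2 * \<beta>y))\<close>.

  An inexact step is compared with the previous iterate of the same block, whose divergence is not
  controlled by the current one of the other block. The induction therefore runs on an upper bound
  \<open>B t\<close> for the divergence of \<open>y t\<close>: as \<open>qx\<close> and \<open>qy\<close> are at least \<open>7 / 10\<close>, the bounds of consecutive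
  half steps differ by a factor of at least \<open>7 / 10\<close>, so the previous iterate costs at most
  \<open>10 / 7\<close> times the current bound, and \<open>10 / 7 + 1 \<le> 3\<close> explains the factor 3 in \<open>r\<close>.
\<close>

lemma is_norm_nonneg:
  assumes "is_norm N"
  shows "0 \<le> N v"
proof -
  have "N (v + (-1) *\<^sub>R v) \<le> N v + N ((-1) *\<^sub>R v)" "N ((-1) *\<^sub>R v) = \<bar>-1\<bar> * N v" "N 0 = 0"
    using assms unfolding is_norm_def by blast+
  then show ?thesis by simp
qed

lemma bdd_above_dual_norm:
  fixes g :: "'a::real_inner"
  assumes "\<forall>u. norm u \<le> N u"
  shows "bdd_above ((\<lambda>u. g \<bullet> u) ` {u. N u \<le> 1})"
proof (rule bdd_aboveI2)
  fix u assume "u \<in> {u. N u \<le> 1}"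
  then have "norm u \<le> 1" using assms order_trans by blast
  then have "norm g * norm u \<le> norm g * 1" by (intro mult_left_mono) auto
  then show "g \<bullet> u \<le> norm g" using norm_cauchy_schwarz[of g u] by simp
qed

lemma inner_le_dual_norm:
  fixes g :: "'a::real_inner"
  assumes N: "is_norm N" and ge: "\<forall>u. norm u \<le> N u"
  shows "g \<bullet> u \<le> dual_norm N g * N u"
proof (cases "u = 0")
  case True
  moreover have "N 0 = 0" using N unfolding is_norm_def by blast
  ultimately show ?thesis by simp
next
  case False
  then have pos: "0 < N u"
    using N is_norm_nonneg[OF N, of u] unfolding is_norm_def by (metis less_eq_real_def)
  have "N ((1 / N u) *\<^sub>R u) = \<bar>1 / N u\<bar> * N u" using N unfolding is_norm_def by blast
  then have "N ((1 / N u) *\<^sub>R u) \<le> 1" using pos by simp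
  then have "g \<bullet> ((1 / N u) *\<^sub>R u) \<le> dual_norm N g"
    unfolding dual_norm_def by (intro cSUP_upper bdd_above_dual_norm[OF ge]) auto
  then show ?thesis using pos by (simp add: field_simps)
qed

lemma dual_norm_nonneg:
  fixes g :: "'a::real_inner"
  assumes N: "is_norm N" and ge: "\<forall>u. norm u \<le> N u"
  shows "0 \<le> dual_norm N g"
proof -
  have "N 0 = 0" using N unfolding is_norm_def by blast
  then have "g \<bullet> 0 \<le> dual_norm N g"
    unfolding dual_norm_def by (intro cSUP_upper bdd_above_dual_norm[OF ge]) auto
  then show ?thesis by simp
qed

lemma dual_norm_eq_0:
  fixes g :: "'a::real_inner"
  assumes N: "is_norm N" and ge: "\<forall>u. norm u \<le> N u" and "dual_norm N g = 0"
  shows "g = 0"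
proof -
  have "g \<bullet> g \<le> 0" using inner_le_dual_norm[OF N ge, of g g] assms(3) by simp
  then show ?thesis by (metis inner_eq_zero_iff inner_ge_zero order_antisym)
qed

lemma GDERIV_fst:
  assumes "GDERIV L (u, v) :> g"
  shows "GDERIV (\<lambda>u. L (u, v)) u :> fst g"
proof -
  have "((\<lambda>w. L (w, v)) has_derivative (\<lambda>h. (h, 0) \<bullet> g)) (at u)"
    using assms unfolding gderiv_def
    by (intro has_derivative_compose[where g = L and f = "\<lambda>w. (w, v)"] derivative_eq_intros) auto
  then show ?thesis unfolding gderiv_def by (simp add: inner_prod_def)
qed

lemma GDERIV_snd:
  assumes "GDERIV L (u, v) :> g"
  shows "GDERIV (\<lambda>v. L (u, v)) v :> snd g"
proof -
  have "((\<lambda>w. L (u, w)) has_derivative (\<lambda>h. (0, h) \<bullet> g)) (at v)"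
    using assms unfolding gderiv_def
    by (intro has_derivative_compose[where g = L and f = "\<lambda>w. (u, w)"] derivative_eq_intros) auto
  then show ?thesis unfolding gderiv_def by (simp add: inner_prod_def)
qed

lemma gradient_eqI:
  assumes "GDERIV f x :> g"
  shows "gradient f x = g"
  unfolding gradient_def using assms by (rule the_equality) (rule gderiv_unique[OF _ assms])

lemma
  fixes L :: "'a::euclidean_space \<times> 'b::euclidean_space \<Rightarrow> real"
  assumes "L differentiable (at (u, v))"
  shows GDERIV_grad_x: "GDERIV (\<lambda>u. L (u, v)) u :> grad_x L u v"
    and GDERIV_grad_y: "GDERIV (\<lambda>v. L (u, v)) v :> grad_y L u v"
    and gradient_Pair: "gradient L (u, v) = (grad_x L u v, grad_y L u v)"
proof -
  note g = gderiv_gradient[OF assms]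
  have *: "grad_x L u v = fst (gradient L (u, v))" "grad_y L u v = snd (gradient L (u, v))"
    unfolding grad_x_def grad_y_def
    by (intro gradient_eqI GDERIV_fst GDERIV_snd g)+
  show "GDERIV (\<lambda>u. L (u, v)) u :> grad_x L u v" "GDERIV (\<lambda>v. L (u, v)) v :> grad_y L u v"
    unfolding * by (intro GDERIV_fst GDERIV_snd g)+
  show "gradient L (u, v) = (grad_x L u v, grad_y L u v)" unfolding * by simp
qed

lemma first_order_optimality:
  fixes f :: "'a::euclidean_space \<Rightarrow> real"
  assumes N: "is_norm N" and ge: "\<forall>u. norm u \<le> N u"
    and f: "GDERIV f z :> g"
    and min: "\<forall>w\<in>Z. f z \<le> f w"
    and curv: "curvature_cond N Z z (ennreal \<gamma>)" and \<gamma>: "0 \<le> \<gamma>"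
    and z': "z' \<in> Z"
  shows "- (\<gamma> * dual_norm N g * (norm (z' - z))\<^sup>2) \<le> (z' - z) \<bullet> g"
proof -
  define k where "k = \<gamma> * (norm (z - z'))\<^sup>2"
  define G where "G = dual_norm N g"
  define d where "d = norm (z' - z)"
  define p where "p = (\<lambda>t::real. (1 - t) *\<^sub>R z + t *\<^sub>R z')"
  have k0: "0 \<le> k" and G0: "0 \<le> G"
    unfolding k_def G_def using \<gamma> dual_norm_nonneg[OF N ge] by simp_all
  have "0 \<le> (z' - z) \<bullet> g + G * (k + \<eta>) + \<eta> * (d + k + \<eta>)" if \<eta>: "0 < \<eta>" for \<eta>
  proof -
    define m where "m = d + k + \<eta>"
    have m: "0 < m" unfolding m_def d_def using k0 \<eta> by (simp add: add_nonneg_pos)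
    have "\<exists>\<delta>>0. \<forall>w. norm (w - z) < \<delta> \<longrightarrow> norm (f w - f z - (w - z) \<bullet> g) \<le> \<eta> * norm (w - z)"
      using f \<eta> unfolding gderiv_def has_derivative_at_alt by blast
    then obtain \<delta> where \<delta>: "0 < \<delta>"
      and F: "\<And>w. norm (w - z) < \<delta> \<Longrightarrow> norm (f w - f z - (w - z) \<bullet> g) \<le> \<eta> * norm (w - z)"
      by blast
    have "Limsup (at_right 0) (\<lambda>t. ennreal ((INF w\<in>Z. N (w - p t)) / t)) \<le> ennreal k"
      using curv z' \<gamma> unfolding curvature_cond_def k_def p_def by (simp add: ennreal_mult)
    also have "\<dots> < ennreal (k + \<eta>)" using k0 \<eta> by (simp add: ennreal_less_iff)
    finally have "\<forall>\<^sub>F t in at_right 0. ennreal ((INF w\<in>Z. N (w - p t)) / t) < ennreal (k + \<eta>)"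
      by (rule Limsup_lessD)
    moreover have "\<forall>\<^sub>F t in at_right 0. t < \<delta> / m"
      using \<delta> m eventually_at_right_real[of 0 "\<delta> / m"] by (auto elim: eventually_mono)
    moreover have "\<forall>\<^sub>F t in at_right (0::real). 0 < t" by (rule eventually_at_right_less)
    ultimately have "\<forall>\<^sub>F t in at_right 0. 0 < t \<and> t < \<delta> / m
        \<and> ennreal ((INF w\<in>Z. N (w - p t)) / t) < ennreal (k + \<eta>)"
      by eventually_elim blast
    then obtain t where t: "0 < t" "t < \<delta> / m"
      and lt: "ennreal ((INF w\<in>Z. N (w - p t)) / t) < ennreal (k + \<eta>)"
      using eventually_happens'[OF trivial_limit_at_right_real] by blast
    have "(INF w\<in>Z. N (w - p t)) / t < k + \<eta>"
      using lt by (meson ennreal_leI not_less)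
    then have "(INF w\<in>Z. N (w - p t)) < t * (k + \<eta>)"
      using t by (simp add: field_simps)
    moreover have "bdd_below ((\<lambda>w. N (w - p t)) ` Z)"
      using is_norm_nonneg[OF N] by (intro bdd_belowI2[of _ 0]) simp
    ultimately obtain w where w: "w \<in> Z" and Nw: "N (w - p t) < t * (k + \<eta>)"
      using cINF_less_iff[of Z] z' by blast
    have wz: "w - z = t *\<^sub>R (z' - z) + (w - p t)"
      unfolding p_def by (simp add: algebra_simps)
    have "norm (w - z) \<le> norm (t *\<^sub>R (z' - z)) + norm (w - p t)"
      unfolding wz by (rule norm_triangle_ineq)
    also have "\<dots> \<le> t * d + N (w - p t)" using t ge by (simp add: d_def)
    also have "\<dots> \<le> t * m" using Nw by (simp add: m_def algebra_simps)
    finally have nw: "norm (w - z) \<le> t * m" .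
    also have "\<dots> < \<delta>" using t m by (simp add: field_simps)
    finally have "f w - f z - (w - z) \<bullet> g \<le> \<eta> * norm (w - z)" using F[of w] by simp
    also have "\<dots> \<le> \<eta> * (t * m)" using nw \<eta> by simp
    finally have "0 \<le> (w - z) \<bullet> g + \<eta> * (t * m)" using min w by force
    also have "(w - z) \<bullet> g = t * ((z' - z) \<bullet> g) + g \<bullet> (w - p t)"
      unfolding wz by (simp add: inner_add_left inner_commute[of g])
    also have "g \<bullet> (w - p t) \<le> G * N (w - p t)"
      unfolding G_def by (rule inner_le_dual_norm[OF N ge])
    also have "G * N (w - p t) \<le> G * (t * (k + \<eta>))" using G0 Nw by (intro mult_left_mono) auto
    finally have "0 \<le> t * ((z' - z) \<bullet> g + G * (k + \<eta>) + \<eta> * m)" by (simp add: algebra_simps)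
    then show ?thesis using t unfolding m_def by (simp add: zero_le_mult_iff)
  qed
  then have ev: "\<forall>\<^sub>F \<eta> in at_right 0. 0 \<le> (z' - z) \<bullet> g + G * (k + \<eta>) + \<eta> * (d + k + \<eta>)"
    using eventually_at_right_less[of "0::real"] by (auto elim: eventually_mono)
  have "((\<lambda>\<eta>. (z' - z) \<bullet> g + G * (k + \<eta>) + \<eta> * (d + k + \<eta>)) \<longlongrightarrow>
      (z' - z) \<bullet> g + G * (k + 0) + 0 * (d + k + 0)) (at_right 0)"
    by (intro tendsto_intros)
  from tendsto_lowerbound[OF this ev] show ?thesis
    unfolding k_def G_def by (simp add: norm_minus_commute algebra_simps)
qed

lemma curvature_cond_concavity:
  assumes N: "is_norm N" and z: "z \<in> Z" and fin: "concavity N Z = ennreal \<gamma>"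
  shows "curvature_cond N Z z (ennreal \<gamma>)"
proof -
  have le: "local_concavity N Z z \<le> ennreal \<gamma>"
    unfolding fin[symmetric] concavity_def using z by (rule SUP_upper)
  then have "\<not> degenerate Z z"
    unfolding local_concavity_def by (auto simp: top_unique infinity_ennreal_def)
  then have "(LEAST \<gamma>. curvature_cond N Z z \<gamma>) \<le> ennreal \<gamma>"
    using le unfolding local_concavity_def by simp
  then show ?thesis
    using curvature_cond_Least[OF N z] unfolding curvature_cond_def
    by (meson mult_right_mono order_trans zero_le)
qed

text \<open>If the concavity coefficient is infinite, the convention \<open>0 \<cdot> \<infinity> = 0\<close> leaves only
  the case in which both gradients vanish.\<close>

lemma minimizers_gradient_bound:
  fixes f1 f2 :: "'a::euclidean_space \<Rightarrow> real"
  assumes N: "is_norm N" and ge: "\<forall>u. norm u \<le> N u"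
    and f1: "GDERIV f1 z1 :> g1" and min1: "is_arg_min f1 (\<lambda>u. u \<in> Z) z1"
    and f2: "GDERIV f2 z2 :> g2" and min2: "is_arg_min f2 (\<lambda>u. u \<in> Z) z2"
    and S: "ennreal (dual_norm N g2) \<le> S"
    and init: "2 * concavity N Z * (ennreal (dual_norm N g1) + S) \<le> ennreal K"
    and K: "0 \<le> K"
  shows "(z2 - z1) \<bullet> (g2 - g1) \<le> K / 2 * (norm (z2 - z1))\<^sup>2"
proof -
  have z: "z1 \<in> Z" "z2 \<in> Z" and m: "\<forall>w\<in>Z. f1 z1 \<le> f1 w" "\<forall>w\<in>Z. f2 z2 \<le> f2 w"
    using min1 min2 by (auto simp: is_arg_min_linorder)
  have nn: "0 \<le> dual_norm N g1" "0 \<le> dual_norm N g2"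
    using dual_norm_nonneg[OF N ge] by auto
  have "2 * concavity N Z * (ennreal (dual_norm N g1) + ennreal (dual_norm N g2))
      \<le> 2 * concavity N Z * (ennreal (dual_norm N g1) + S)"
    by (intro mult_left_mono add_left_mono S) auto
  with init have le: "2 * concavity N Z * ennreal (dual_norm N g1 + dual_norm N g2) \<le> ennreal K"
    using nn by (auto simp: ennreal_plus)
  show ?thesis
  proof (cases "concavity N Z")
    case (real \<gamma>)
    have "ennreal (2 * \<gamma> * (dual_norm N g1 + dual_norm N g2)) \<le> ennreal K"
      using le real nn by (simp add: ennreal_mult)
    then have "2 * \<gamma> * (dual_norm N g1 + dual_norm N g2) \<le> K"
      using K by (simp add: ennreal_le_iff)
    then have "2 * \<gamma> * (dual_norm N g1 + dual_norm N g2) * (norm (z2 - z1))\<^sup>2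
        \<le> K * (norm (z2 - z1))\<^sup>2"
      by (rule mult_right_mono) simp
    moreover have "- (\<gamma> * dual_norm N g1 * (norm (z2 - z1))\<^sup>2) \<le> (z2 - z1) \<bullet> g1"
      using real z by (intro first_order_optimality[OF N ge f1 m(1)] curvature_cond_concavity[OF N]) auto
    moreover have "- (\<gamma> * dual_norm N g2 * (norm (z1 - z2))\<^sup>2) \<le> (z1 - z2) \<bullet> g2"
      using real z by (intro first_order_optimality[OF N ge f2 m(2)] curvature_cond_concavity[OF N]) auto
    ultimately show ?thesis
      by (simp add: norm_minus_commute inner_diff_left inner_diff_right algebra_simps)
  next
    case top
    then have "dual_norm N g1 + dual_norm N g2 = 0"
      using le nn by (cases "dual_norm N g1 + dual_norm N g2 = 0")
        (auto simp: ennreal_mult_top ennreal_top_mult top_unique ennreal_mult_eq_top_iff split: if_splits)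
    then have "g1 = 0" "g2 = 0" using nn dual_norm_eq_0[OF N ge] by (smt (verit))+
    then show ?thesis using K by simp
  qed
qed

text \<open>Here \<open>a\<close> and \<open>b\<close> are the distances of an exact half step and of the
  current iterate of the other block from the target, \<open>P\<close> and \<open>Q\<close> are the two blocks of the
  monotonicity product, and \<open>Da\<close>, \<open>Db\<close> the squared divergences.\<close>

lemma divergence_contraction:
  fixes Da Db :: real
  assumes P: "P \<le> (\<alpha> - \<mu>) / 2 * a\<^sup>2"
    and rsc: "\<alpha> * a\<^sup>2 + \<alpha>' * b\<^sup>2 - E \<le> P + Q"
    and cross: "\<bar>(P - Da) - (Q - Db)\<bar> \<le> 1 / 2 * \<mu> * a\<^sup>2 + 1 / 2 * \<mu>' * b\<^sup>2 + E"
    and smooth: "Db \<le> \<beta>' * b\<^sup>2 + E"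
    and params: "0 \<le> \<mu>" "\<mu>' \<le> \<alpha>'" "0 < \<alpha>'" "\<alpha>' \<le> \<beta>'" "0 \<le> E"
  shows "sqrt (max 0 Da) \<le> sqrt (1 - \<alpha>' / (2 * \<beta>')) * sqrt (max 0 Db) + 8 / 5 * sqrt E"
proof -
  define \<theta> where "\<theta> = \<alpha>' / (2 * \<beta>')"
  have \<theta>: "0 \<le> \<theta>" "\<theta> \<le> 1 / 2" "\<theta> * \<beta>' = \<alpha>' / 2" using params by (auto simp: \<theta>_def field_simps)
  have "2 * P - (P - Da - (Q - Db)) = P + Q + Da - Db" by simp
  then have "Da \<le> 2 * P + (1 / 2 * \<mu> * a\<^sup>2 + 1 / 2 * \<mu>' * b\<^sup>2 + E) + Db - \<alpha> * a\<^sup>2 - \<alpha>' * b\<^sup>2 + E"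
    using rsc cross by linarith
  also have "\<dots> \<le> Db - (1 / 2) * (\<mu> * a\<^sup>2) - \<alpha>' * b\<^sup>2 + 1 / 2 * (\<mu>' * b\<^sup>2) + 2 * E"
    using P by (simp add: algebra_simps)
  also have "\<dots> \<le> Db - \<alpha>' / 2 * b\<^sup>2 + 2 * E"
    using mult_right_mono[OF params(2), of "b\<^sup>2"] mult_nonneg_nonneg[OF params(1), of "a\<^sup>2"] by simp
  also have "\<alpha>' / 2 * b\<^sup>2 = \<theta> * (\<beta>' * b\<^sup>2)" using \<theta>(3) by (metis mult.assoc)
  also have "Db - \<theta> * (\<beta>' * b\<^sup>2) + 2 * E \<le> Db - \<theta> * (Db - E) + 2 * E"
    using mult_left_mono[OF smooth \<theta>(1)] by (simp add: algebra_simps)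
  also have "\<dots> \<le> (1 - \<theta>) * Db + 5 / 2 * E"
    using mult_right_mono[OF \<theta>(2) params(5)] by (simp add: algebra_simps)
  also have "\<dots> \<le> (1 - \<theta>) * max 0 Db + 5 / 2 * E"
    using \<theta> by (intro add_right_mono mult_left_mono) auto
  finally have "max 0 Da \<le> (1 - \<theta>) * max 0 Db + 5 / 2 * E" using \<theta> params(5) by simp
  then have "sqrt (max 0 Da) \<le> sqrt ((1 - \<theta>) * max 0 Db + 5 / 2 * E)" by simp
  also have "\<dots> \<le> sqrt ((1 - \<theta>) * max 0 Db) + sqrt (5 / 2 * E)"
    using \<theta> params(5) by (intro sqrt_add_le_add_sqrt) auto
  also have "sqrt (5 / 2 * E) \<le> sqrt ((8 / 5)\<^sup>2 * E)"
    using params(5) by (intro real_sqrt_le_mono mult_right_mono) (auto simp: power2_eq_square)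
  finally show ?thesis unfolding \<theta>_def by (simp add: real_sqrt_mult)
qed

lemma inexact_half_step:
  fixes B :: real
  assumes contraction: "Dexact \<le> q * B + 8 / 5 * s"
    and prev: "sqrt \<alpha> * dprev \<le> 10 / 7 * B + s"
    and exact: "sqrt \<alpha> * dexact \<le> Dexact + s"
    and new: "Dnew \<le> Dexact + sqrt \<beta> * \<delta> + s"
    and \<delta>: "\<delta> \<le> c * (dprev + dexact) + C * e"
    and params: "0 < \<alpha>" "0 \<le> \<beta>" "0 \<le> c" "q \<le> 1" "0 \<le> B" "0 \<le> s"
    and small: "c * sqrt (\<beta> / \<alpha>) \<le> 1 / 4"
  shows "Dnew \<le> (q + 3 * c * sqrt (\<beta> / \<alpha>)) * B + (7 / 2 * s + sqrt \<beta> * (C * e))"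
proof -
  define k where "k = c * sqrt (\<beta> / \<alpha>)"
  have k: "0 \<le> k" "k \<le> 1 / 4" using params small by (simp_all add: k_def)
  have kb: "sqrt \<beta> * c = k * sqrt \<alpha>" using params by (simp add: k_def real_sqrt_divide)
  have qB: "q * B \<le> B" using params by (simp add: mult_left_le_one_le mult_le_cancel_right2)
  have "sqrt \<beta> * \<delta> \<le> sqrt \<beta> * (c * (dprev + dexact) + C * e)"
    using \<delta> params by (intro mult_left_mono) auto
  also have "\<dots> = k * (sqrt \<alpha> * dprev + sqrt \<alpha> * dexact) + sqrt \<beta> * (C * e)"
    using kb by (simp add: distrib_left mult.assoc[symmetric])
  also have "k * (sqrt \<alpha> * dprev + sqrt \<alpha> * dexact) \<le> k * (3 * B + 18 / 5 * s)"
    using prev exact contraction qB params by (intro mult_left_mono k) linarith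
  finally have "sqrt \<beta> * \<delta> \<le> 3 * k * B + 18 / 5 * (k * s) + sqrt \<beta> * (C * e)"
    by (simp add: algebra_simps)
  moreover have "k * s \<le> 1 / 4 * s" using k params by (intro mult_right_mono)
  ultimately have "Dnew \<le> q * B + 3 * k * B + (7 / 2 * s + sqrt \<beta> * (C * e))"
    using new contraction by linarith
  then show ?thesis by (simp add: k_def algebra_simps)
qed

lemma contraction_factor_bounds:
  fixes \<alpha> \<beta> :: real
  assumes "0 < \<alpha>" "\<alpha> \<le> \<beta>"
  shows "7 / 10 \<le> sqrt (1 - \<alpha> / (2 * \<beta>))" "sqrt (1 - \<alpha> / (2 * \<beta>)) \<le> 1"
proof -
  have *: "\<alpha> / (2 * \<beta>) \<le> 1 / 2" "0 \<le> \<alpha> / (2 * \<beta>)" using assms by (auto simp: field_simps)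
  have "(7 / 10)\<^sup>2 \<le> 1 - \<alpha> / (2 * \<beta>)" using *(1) unfolding power2_eq_square by linarith
  then show "7 / 10 \<le> sqrt (1 - \<alpha> / (2 * \<beta>))" by (rule real_le_rsqrt)
  show "sqrt (1 - \<alpha> / (2 * \<beta>)) \<le> 1" using *(2) by simp
qed

lemma factors_small:
  fixes q q' k k' :: real
  assumes "7 / 10 \<le> q" "7 / 10 \<le> q'" "0 \<le> k" "0 \<le> k'" "(q + 3 * k) * (q' + 3 * k') < 1"
  shows "q + 3 * k \<le> 10 / 7" "k \<le> 1 / 4"
proof -
  have "(q + 3 * k) * (7 / 10) \<le> (q + 3 * k) * (q' + 3 * k')"
    using assms by (intro mult_left_mono) auto
  then show "q + 3 * k \<le> 10 / 7" using assms by simp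
  then show "k \<le> 1 / 4" using assms by simp
qed

lemma sqrt_mult_le_divergence:
  fixes D :: real
  assumes "\<alpha> * d\<^sup>2 \<le> D + E" "0 \<le> \<alpha>" "0 \<le> d" "0 \<le> E"
  shows "sqrt \<alpha> * d \<le> sqrt (max 0 D) + sqrt E"
proof -
  have "sqrt \<alpha> * d = sqrt (\<alpha> * d\<^sup>2)" using assms by (simp add: real_sqrt_mult)
  also have "\<dots> \<le> sqrt (max 0 D + E)" using assms by simp
  also have "\<dots> \<le> sqrt (max 0 D) + sqrt E" using assms by (intro sqrt_add_le_add_sqrt) auto
  finally show ?thesis .
qed

theorem lemma3:
  fixes L :: "(real ^ 'm) \<times> (real ^ 'n) \<Rightarrow> real"
    and X X0 :: "(real ^ 'm) set" and Y Y0 :: "(real ^ 'n) set"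
    and normx :: "real ^ 'm \<Rightarrow> real" and normy :: "real ^ 'n \<Rightarrow> real"
    and xh :: "real ^ 'm" and yh :: "real ^ 'n"
    and xmin :: "real ^ 'n \<Rightarrow> real ^ 'm" and ymin :: "real ^ 'm \<Rightarrow> real ^ 'n"
    and x :: "nat \<Rightarrow> real ^ 'm" and y :: "nat \<Rightarrow> real ^ 'n"
    and \<rho>x \<rho>y \<alpha>x \<alpha>y \<beta>x \<beta>y \<mu>x \<mu>y \<epsilon>x \<epsilon>y cx cy Cx Cy r C :: real
    and \<delta>x \<delta>y :: "nat \<Rightarrow> real"
  assumes normx: "is_norm normx" "\<forall>u. norm u \<le> normx u"
    and normy: "is_norm normy" "\<forall>v. norm v \<le> normy v"
    and L_diff: "\<forall>z. L differentiable (at z)"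
    and closed: "closed X" "closed Y"
    and start: "x 0 \<in> X" "y 0 \<in> Y"
    and radii: "\<rho>x > 0" "\<rho>y > 0"
    and X0_eq: "X0 = X \<inter> cball (x 0) \<rho>x"
    and Y0_eq: "Y0 = Y \<inter> cball (y 0) \<rho>y"
    and argmin_joint: "is_arg_min L (\<lambda>z. z \<in> X0 \<times> Y0) (xh, yh)"
    and argmin_x: "\<forall>v\<in>Y0. is_arg_min (\<lambda>u. L (u, v)) (\<lambda>u. u \<in> X0) (xmin v)"
    and argmin_y: "\<forall>u\<in>X0. is_arg_min (\<lambda>v. L (u, v)) (\<lambda>v. v \<in> Y0) (ymin u)"
    and consts_x: "0 < \<alpha>x" "\<alpha>x \<le> \<beta>x" "0 \<le> \<mu>x" "\<mu>x \<le> \<alpha>x" "0 \<le> \<epsilon>x"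
    and consts_y: "0 < \<alpha>y" "\<alpha>y \<le> \<beta>y" "0 \<le> \<mu>y" "\<mu>y \<le> \<alpha>y" "0 \<le> \<epsilon>y"
    and joint_restricted_strong_convexity:
      "\<forall>u\<in>X0. \<forall>v\<in>Y0.
         (u - xh, v - yh) \<bullet> (gradient L (u, v) - gradient L (xh, yh))
         \<ge> \<alpha>x * (norm (u - xh))\<^sup>2 + \<alpha>y * (norm (v - yh))\<^sup>2 - \<alpha>x * \<epsilon>x\<^sup>2 - \<alpha>y * \<epsilon>y\<^sup>2"
    and restricted_smoothness:
      "\<forall>u\<in>X0. Dsq_x L xh yh u \<le> \<beta>x * (norm (u - xh))\<^sup>2 + \<alpha>x * \<epsilon>x\<^sup>2"
      "\<forall>v\<in>Y0. Dsq_y L xh yh v \<le> \<beta>y * (norm (v - yh))\<^sup>2 + \<alpha>y * \<epsilon>y\<^sup>2"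
    and cross_product_bound:
      "\<forall>u\<in>X0. \<forall>v\<in>Y0.
         \<bar>(u - xh) \<bullet> (grad_x L u v - grad_x L u yh) - (v - yh) \<bullet> (grad_y L u v - grad_y L xh v)\<bar>
         \<le> 1 / 2 * \<mu>x * (norm (u - xh))\<^sup>2 + 1 / 2 * \<mu>y * (norm (v - yh))\<^sup>2
           + \<alpha>x * \<epsilon>x\<^sup>2 + \<alpha>y * \<epsilon>y\<^sup>2"
    and initialization:
      "2 * concavity normx X0 *
         (ennreal (dual_norm normx (grad_x L xh yh))
          + (SUP v\<in>Y0. ennreal (dual_norm normx (grad_x L (xmin v) v))))
       \<le> ennreal (\<alpha>x - \<mu>x)"
      "2 * concavity normy Y0 *
         (ennreal (dual_norm normy (grad_y L xh yh))
          + (SUP u\<in>X0. ennreal (dual_norm normy (grad_y L u (ymin u)))))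
       \<le> ennreal (\<alpha>y - \<mu>y)"
    and relaxed_triangle:
      "\<forall>u\<in>X0. \<forall>u'\<in>X0.
         D_x L xh yh u \<le> D_x L xh yh u' + sqrt \<beta>x * norm (u - u') + sqrt \<alpha>x * \<epsilon>x"
      "\<forall>v\<in>Y0. \<forall>v'\<in>Y0.
         D_y L xh yh v \<le> D_y L xh yh v' + sqrt \<beta>y * norm (v - v') + sqrt \<alpha>y * \<epsilon>y"
    and tolerances: "\<forall>t\<ge>1. 0 \<le> \<delta>x t" "\<forall>t\<ge>1. 0 \<le> \<delta>y t"
    and step_x: "\<forall>t\<ge>1. x t \<in> X0 \<inter> cball (xmin (y (t - 1))) (\<delta>x t)"
    and step_y: "\<forall>t\<ge>1. y t \<in> Y0 \<inter> cball (ymin (x t)) (\<delta>y t)"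
    and inexactness_consts: "0 \<le> cx" "0 \<le> cy" "0 \<le> Cx" "0 \<le> Cy"
    and inexactness_x: "\<forall>t\<ge>1. \<delta>x t \<le> cx * norm (x (t - 1) - xmin (y (t - 1))) + Cx * \<epsilon>x"
    and inexactness_y: "\<forall>t\<ge>1. \<delta>y t \<le> cy * norm (y (t - 1) - ymin (x t)) + Cy * \<epsilon>y"
    and r_eq: "r = (sqrt (1 - \<alpha>x / (2 * \<beta>x)) + 3 * cy * sqrt (\<beta>y / \<alpha>y))
                   * (sqrt (1 - \<alpha>y / (2 * \<beta>y)) + 3 * cx * sqrt (\<beta>x / \<alpha>x))"
    and r_less: "r < 1"
    and C_eq: "C = 39 / (1 - r) *
                   sqrt ((\<alpha>x + \<alpha>y + Cx\<^sup>2 * \<beta>x + Cy\<^sup>2 * \<beta>y) / min \<alpha>x \<alpha>y)"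
  shows "\<forall>t\<ge>1. norm ((x t, y t) - (xh, yh))
           \<le> r ^ t * (sqrt (6 * (\<alpha>x * \<rho>x\<^sup>2 + \<beta>y * \<rho>y\<^sup>2)) / sqrt (min \<alpha>x \<alpha>y))
              + C * max \<epsilon>x \<epsilon>y"
proof -
  define E where "E = \<alpha>x * \<epsilon>x\<^sup>2 + \<alpha>y * \<epsilon>y\<^sup>2"
  define e where "e = max \<epsilon>x \<epsilon>y"
  define s where "s = sqrt (\<alpha>x + \<alpha>y) * e"
  define M where "M = sqrt (\<alpha>x + \<alpha>y + Cx\<^sup>2 * \<beta>x + Cy\<^sup>2 * \<beta>y)"
  define qx where "qx = sqrt (1 - \<alpha>y / (2 * \<beta>y))"
  define qy where "qy = sqrt (1 - \<alpha>x / (2 * \<beta>x))"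
  define kx where "kx = cx * sqrt (\<beta>x / \<alpha>x)"
  define ky where "ky = cy * sqrt (\<beta>y / \<alpha>y)"
  define px where "px = qx + 3 * kx"
  define py where "py = qy + 3 * ky"
  define n where "n = 9 / 2 * (M * e)"
  define R where "R = sqrt (\<alpha>x * \<rho>x\<^sup>2 + \<beta>y * \<rho>y\<^sup>2)"
  define W where "W = 17 / 7 * n / (1 - r)"
  define B where "B t = r ^ t * R + W" for t
  let ?Dx = "D_x L xh yh" and ?Dy = "D_y L xh yh"

  have \<beta>: "0 < \<beta>x" "0 < \<beta>y" using consts_x consts_y by auto
  have e: "0 \<le> e" "\<epsilon>x \<le> e" "\<epsilon>y \<le> e" unfolding e_def using consts_x by auto
  have ax: "0 \<le> \<alpha>x * \<epsilon>x\<^sup>2" and ay: "0 \<le> \<alpha>y * \<epsilon>y\<^sup>2" using consts_x consts_y by auto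
  have E0: "0 \<le> E" unfolding E_def using ax ay by simp
  have sE: "sqrt E \<le> s"
  proof -
    have "E \<le> \<alpha>x * e\<^sup>2 + \<alpha>y * e\<^sup>2"
      unfolding E_def using consts_x consts_y e
      by (intro add_mono mult_left_mono power_mono) auto
    also have "\<dots> = (\<alpha>x + \<alpha>y) * e\<^sup>2" by (simp add: algebra_simps)
    finally have "sqrt E \<le> sqrt ((\<alpha>x + \<alpha>y) * e\<^sup>2)" by simp
    then show ?thesis unfolding s_def using e by (simp add: real_sqrt_mult)
  qed
  have s0: "0 \<le> s" unfolding s_def using consts_x consts_y e by simp
  have sx: "sqrt \<alpha>x * \<epsilon>x \<le> s" and sy: "sqrt \<alpha>y * \<epsilon>y \<le> s"
    unfolding s_def using consts_x consts_y e by (intro mult_mono; simp)+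
  have nonneg: "0 \<le> Cx\<^sup>2 * \<beta>x" "0 \<le> Cy\<^sup>2 * \<beta>y" using \<beta> by auto
  have sM: "s \<le> M * e"
    unfolding s_def M_def using e nonneg by (intro mult_right_mono) auto
  have "sqrt (Cx\<^sup>2 * \<beta>x) \<le> M" "sqrt (Cy\<^sup>2 * \<beta>y) \<le> M"
    unfolding M_def using consts_x consts_y nonneg by (auto intro!: real_sqrt_le_mono)
  then have CM: "sqrt \<beta>x * Cx \<le> M" "sqrt \<beta>y * Cy \<le> M"
    using inexactness_consts by (auto simp: real_sqrt_mult mult.commute)
  have Ce: "sqrt \<beta>x * (Cx * e) \<le> M * e" "sqrt \<beta>y * (Cy * e) \<le> M * e"
    using mult_right_mono[OF CM(1) e(1)] mult_right_mono[OF CM(2) e(1)] by (simp_all add: mult.assoc)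
  have noise: "7 / 2 * s + sqrt \<beta>x * (Cx * e) \<le> n" "7 / 2 * s + sqrt \<beta>y * (Cy * e) \<le> n"
    unfolding n_def using sM Ce by linarith+
  have n0: "0 \<le> n" and sn: "s \<le> n" unfolding n_def using sM s0 by linarith+
  have q: "7 / 10 \<le> qx" "qx \<le> 1" "7 / 10 \<le> qy" "qy \<le> 1"
    unfolding qx_def qy_def using contraction_factor_bounds consts_x consts_y by auto
  have k0: "0 \<le> kx" "0 \<le> ky" unfolding kx_def ky_def using inexactness_consts consts_x consts_y by auto
  have r_p: "r = py * px" unfolding r_eq px_def py_def qx_def qy_def kx_def ky_def by (simp add: mult.assoc)
  have p: "px \<le> 10 / 7" "kx \<le> 1 / 4" "py \<le> 10 / 7" "ky \<le> 1 / 4"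
    using factors_small[of qx qy kx ky] factors_small[of qy qx ky kx] q k0 r_less
    unfolding r_p px_def py_def by (simp_all add: mult.commute)
  have p7: "7 / 10 \<le> px" "7 / 10 \<le> py" unfolding px_def py_def using q k0 by auto
  have r0: "0 \<le> r" unfolding r_p using p7 by auto
  have R0: "0 \<le> R" unfolding R_def using consts_x \<beta> by simp
  have W0: "0 \<le> W" unfolding W_def using n0 r_less by simp
  have W: "r * W + 17 / 7 * n = W" unfolding W_def using r_less by (simp add: field_simps)
  have nW: "17 / 7 * n \<le> W" using W r0 W0 by (smt (verit) mult_nonneg_nonneg)
  have B0: "0 \<le> B t" for t unfolding B_def using r0 R0 W0 by simp
  have B_Suc: "B (Suc t) = r * B t + 17 / 7 * n" for t
    unfolding B_def using W by (simp add: algebra_simps)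

  have diff: "L differentiable (at z)" for z using L_diff by blast
  note Gx = GDERIV_grad_x[OF diff] and Gy = GDERIV_grad_y[OF diff] and GP = gradient_Pair[OF diff]
  have h: "xh \<in> X0" "yh \<in> Y0" and hmin: "\<And>u v. u \<in> X0 \<Longrightarrow> v \<in> Y0 \<Longrightarrow> L (xh, yh) \<le> L (u, v)"
    using argmin_joint by (auto simp: is_arg_min_linorder)
  have argmin_xh: "is_arg_min (\<lambda>u. L (u, yh)) (\<lambda>u. u \<in> X0) xh"
    and argmin_yh: "is_arg_min (\<lambda>v. L (xh, v)) (\<lambda>v. v \<in> Y0) yh"
    using h hmin by (auto simp: is_arg_min_linorder)
  have mem_x: "xmin v \<in> X0" if "v \<in> Y0" for v using argmin_x that by (auto simp: is_arg_min_linorder)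
  have mem_y: "ymin u \<in> Y0" if "u \<in> X0" for u using argmin_y that by (auto simp: is_arg_min_linorder)

  have rsc: "\<alpha>x * (norm (u - xh))\<^sup>2 + \<alpha>y * (norm (v - yh))\<^sup>2 - E
      \<le> (u - xh) \<bullet> (grad_x L u v - grad_x L xh yh) + (v - yh) \<bullet> (grad_y L u v - grad_y L xh yh)"
    if "u \<in> X0" "v \<in> Y0" for u v
    using joint_restricted_strong_convexity[rule_format, OF that]
    unfolding E_def GP by (simp add: inner_prod_def algebra_simps)
  have cross: "\<bar>((u - xh) \<bullet> (grad_x L u v - grad_x L xh yh) - Dsq_x L xh yh u)
        - ((v - yh) \<bullet> (grad_y L u v - grad_y L xh yh) - Dsq_y L xh yh v)\<bar>
      \<le> 1 / 2 * \<mu>x * (norm (u - xh))\<^sup>2 + 1 / 2 * \<mu>y * (norm (v - yh))\<^sup>2 + E"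
    if "u \<in> X0" "v \<in> Y0" for u v
  proof -
    have "((u - xh) \<bullet> (grad_x L u v - grad_x L xh yh) - Dsq_x L xh yh u)
        - ((v - yh) \<bullet> (grad_y L u v - grad_y L xh yh) - Dsq_y L xh yh v)
      = (u - xh) \<bullet> (grad_x L u v - grad_x L u yh) - (v - yh) \<bullet> (grad_y L u v - grad_y L xh v)"
      unfolding Dsq_x_def Dsq_y_def by (simp add: inner_diff_right)
    then show ?thesis using cross_product_bound[rule_format, OF that] unfolding E_def by simp
  qed
  have smooth_x: "Dsq_x L xh yh u \<le> \<beta>x * (norm (u - xh))\<^sup>2 + E" if "u \<in> X0" for u
    using restricted_smoothness(1) that ay unfolding E_def by fastforce
  have smooth_y: "Dsq_y L xh yh v \<le> \<beta>y * (norm (v - yh))\<^sup>2 + E" if "v \<in> Y0" for v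
    using restricted_smoothness(2) that ax unfolding E_def by fastforce

  have dist_x: "sqrt \<alpha>x * norm (u - xh) \<le> ?Dx u + s" if "u \<in> X0" for u
  proof -
    have "\<alpha>x * (norm (u - xh))\<^sup>2 \<le> Dsq_x L xh yh u + E"
      using rsc[OF that h(2)] by (simp add: Dsq_x_def)
    then show ?thesis
      using sqrt_mult_le_divergence[of \<alpha>x] consts_x E0 sE unfolding D_x_def by fastforce
  qed
  have dist_y: "sqrt \<alpha>y * norm (v - yh) \<le> ?Dy v + s" if "v \<in> Y0" for v
  proof -
    have "\<alpha>y * (norm (v - yh))\<^sup>2 \<le> Dsq_y L xh yh v + E"
      using rsc[OF h(1) that] by (simp add: Dsq_y_def)
    then show ?thesis
      using sqrt_mult_le_divergence[of \<alpha>y] consts_y E0 sE unfolding D_y_def by fastforce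
  qed

  have contr_x: "?Dx (xmin v) \<le> qx * ?Dy v + 8 / 5 * s" if v: "v \<in> Y0" for v
  proof -
    have "(xmin v - xh) \<bullet> (grad_x L (xmin v) v - grad_x L xh yh)
        \<le> (\<alpha>x - \<mu>x) / 2 * (norm (xmin v - xh))\<^sup>2"
      using consts_x v argmin_x
      by (intro minimizers_gradient_bound[OF normx Gx argmin_xh Gx _ _ initialization(1)])
        (auto intro: SUP_upper)
    from divergence_contraction[OF this rsc[OF mem_x[OF v] v] cross[OF mem_x[OF v] v]
        smooth_y[OF v]]
    have "?Dx (xmin v) \<le> qx * ?Dy v + 8 / 5 * sqrt E"
      using consts_x consts_y E0 unfolding D_x_def D_y_def qx_def by simp
    then show ?thesis using sE by simp
  qed
  have contr_y: "?Dy (ymin u) \<le> qy * ?Dx u + 8 / 5 * s" if u: "u \<in> X0" for u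
  proof -
    have P: "(ymin u - yh) \<bullet> (grad_y L u (ymin u) - grad_y L xh yh)
        \<le> (\<alpha>y - \<mu>y) / 2 * (norm (ymin u - yh))\<^sup>2"
      using consts_y u argmin_y
      by (intro minimizers_gradient_bound[OF normy Gy argmin_yh Gy _ _ initialization(2)])
        (auto intro: SUP_upper)
    have "\<alpha>y * (norm (ymin u - yh))\<^sup>2 + \<alpha>x * (norm (u - xh))\<^sup>2 - E
      \<le> (ymin u - yh) \<bullet> (grad_y L u (ymin u) - grad_y L xh yh)
        + (u - xh) \<bullet> (grad_x L u (ymin u) - grad_x L xh yh)"
      using rsc[OF u mem_y[OF u]] by linarith
    moreover have "\<bar>((ymin u - yh) \<bullet> (grad_y L u (ymin u) - grad_y L xh yh) - Dsq_y L xh yh (ymin u))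
        - ((u - xh) \<bullet> (grad_x L u (ymin u) - grad_x L xh yh) - Dsq_x L xh yh u)\<bar>
      \<le> 1 / 2 * \<mu>y * (norm (ymin u - yh))\<^sup>2 + 1 / 2 * \<mu>x * (norm (u - xh))\<^sup>2 + E"
      using cross[OF u mem_y[OF u]] by linarith
    ultimately have "?Dy (ymin u) \<le> qy * ?Dx u + 8 / 5 * sqrt E"
      using divergence_contraction[OF P _ _ smooth_x[OF u]] consts_x consts_y E0
      unfolding D_x_def D_y_def qy_def by blast
    then show ?thesis using sE by simp
  qed

  have x_mem: "x t \<in> X0" for t
    using step_x start radii by (cases "t = 0") (auto simp: X0_eq)
  have y_mem: "y t \<in> Y0" for t
    using step_y start radii by (cases "t = 0") (auto simp: Y0_eq)

  have step: "?Dx (x (Suc t)) \<le> px * B t + n" "?Dy (y (Suc t)) \<le> B (Suc t)"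
    "px * B t + n \<le> 10 / 7 * B (Suc t)"
    if Dy: "?Dy (y t) \<le> B t" and dx: "sqrt \<alpha>x * norm (x t - xh) \<le> 10 / 7 * B t + s" for t
  proof -
    define A where "A = px * B t + n"
    have A0: "0 \<le> A" unfolding A_def using p7 B0[of t] n0 by simp
    have triangle: "norm (a - b) \<le> norm (a - c) + norm (b - c)" for a b c :: "'z::real_normed_vector"
      using dist_triangle2[of a b c] by (simp add: dist_norm)
    let ?u = "xmin (y t)" and ?v = "ymin (x (Suc t))"
    have "qx * ?Dy (y t) \<le> qx * B t" using Dy q by (intro mult_left_mono) auto
    then have c1: "?Dx ?u \<le> qx * B t + 8 / 5 * s" using contr_x[OF y_mem[of t]] by linarith
    have tri1: "?Dx (x (Suc t)) \<le> ?Dx ?u + sqrt \<beta>x * \<delta>x (Suc t) + s"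
    proof -
      have "norm (x (Suc t) - ?u) \<le> \<delta>x (Suc t)"
        using step_x[rule_format, of "Suc t"] by (simp add: dist_norm norm_minus_commute)
      then have "sqrt \<beta>x * norm (x (Suc t) - ?u) \<le> sqrt \<beta>x * \<delta>x (Suc t)"
        using \<beta> by (intro mult_left_mono) auto
      then show ?thesis
        using relaxed_triangle(1)[rule_format, OF x_mem[of "Suc t"] mem_x[OF y_mem[of t]]] sx by linarith
    qed
    have del1: "\<delta>x (Suc t) \<le> cx * (norm (x t - xh) + norm (?u - xh)) + Cx * e"
    proof -
      have "cx * norm (x t - ?u) \<le> cx * (norm (x t - xh) + norm (?u - xh))"
        using inexactness_consts by (intro mult_left_mono triangle)
      moreover have "Cx * \<epsilon>x \<le> Cx * e" using inexactness_consts e by (intro mult_left_mono) auto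
      ultimately show ?thesis using inexactness_x[rule_format, of "Suc t"] by simp
    qed
    have "?Dx (x (Suc t)) \<le> (qx + 3 * cx * sqrt (\<beta>x / \<alpha>x)) * B t + (7 / 2 * s + sqrt \<beta>x * (Cx * e))"
      using p(2) consts_x \<beta> inexactness_consts q B0 s0 unfolding kx_def
      by (intro inexact_half_step[OF c1 dx dist_x[OF mem_x[OF y_mem]] tri1 del1]) auto
    also have "\<dots> \<le> A" unfolding A_def px_def kx_def using noise by (simp add: mult.assoc)
    finally show DA: "?Dx (x (Suc t)) \<le> px * B t + n" by (simp add: A_def)
    have BA: "B t \<le> 10 / 7 * A"
      using mult_right_mono[OF p7(1) B0[of t]] n0 unfolding A_def by simp
    have "qy * ?Dx (x (Suc t)) \<le> qy * A" using DA q by (intro mult_left_mono) (auto simp: A_def)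
    then have c2: "?Dy ?v \<le> qy * A + 8 / 5 * s" using contr_y[OF x_mem[of "Suc t"]] by linarith
    have tri2: "?Dy (y (Suc t)) \<le> ?Dy ?v + sqrt \<beta>y * \<delta>y (Suc t) + s"
    proof -
      have "norm (y (Suc t) - ?v) \<le> \<delta>y (Suc t)"
        using step_y[rule_format, of "Suc t"] by (simp add: dist_norm norm_minus_commute)
      then have "sqrt \<beta>y * norm (y (Suc t) - ?v) \<le> sqrt \<beta>y * \<delta>y (Suc t)"
        using \<beta> by (intro mult_left_mono) auto
      then show ?thesis
        using relaxed_triangle(2)[rule_format, OF y_mem[of "Suc t"] mem_y[OF x_mem[of "Suc t"]]] sy
        by linarith
    qed
    have del2: "\<delta>y (Suc t) \<le> cy * (norm (y t - yh) + norm (?v - yh)) + Cy * e"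
    proof -
      have "cy * norm (y t - ?v) \<le> cy * (norm (y t - yh) + norm (?v - yh))"
        using inexactness_consts by (intro mult_left_mono triangle)
      moreover have "Cy * \<epsilon>y \<le> Cy * e" using inexactness_consts e by (intro mult_left_mono) auto
      ultimately show ?thesis using inexactness_y[rule_format, of "Suc t"] by simp
    qed
    have dy: "sqrt \<alpha>y * norm (y t - yh) \<le> 10 / 7 * A + s"
      using dist_y[OF y_mem[of t]] Dy BA by linarith
    have "?Dy (y (Suc t)) \<le> (qy + 3 * cy * sqrt (\<beta>y / \<alpha>y)) * A + (7 / 2 * s + sqrt \<beta>y * (Cy * e))"
      using p(4) consts_y \<beta> inexactness_consts q A0 s0 unfolding ky_def
      by (intro inexact_half_step[OF c2 dy dist_y[OF mem_y[OF x_mem]] tri2 del2]) auto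
    also have "\<dots> \<le> py * A + n" unfolding py_def ky_def using noise by (simp add: mult.assoc)
    finally have DB: "?Dy (y (Suc t)) \<le> py * A + n" .
    have "py * A + n = r * B t + py * n + n" unfolding A_def r_p by (simp add: algebra_simps)
    also have "\<dots> \<le> B (Suc t)" unfolding B_Suc using mult_right_mono[OF p(3) n0] by simp
    finally have AB: "py * A + n \<le> B (Suc t)" .
    then show "?Dy (y (Suc t)) \<le> B (Suc t)" using DB by simp
    have "A \<le> 10 / 7 * B (Suc t)" using AB mult_right_mono[OF p7(2) A0] n0 by linarith
    then show "px * B t + n \<le> 10 / 7 * B (Suc t)" unfolding A_def .
  qed

  have inv: "?Dy (y t) \<le> B t \<and> sqrt \<alpha>x * norm (x t - xh) \<le> 10 / 7 * B t + s" for t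
  proof (induction t)
    case 0
    have "norm (x 0 - xh) \<le> \<rho>x" "norm (y 0 - yh) \<le> \<rho>y"
      using h by (auto simp: X0_eq Y0_eq dist_norm)
    then have sq: "\<alpha>x * (norm (x 0 - xh))\<^sup>2 \<le> \<alpha>x * \<rho>x\<^sup>2" "\<beta>y * (norm (y 0 - yh))\<^sup>2 \<le> \<beta>y * \<rho>y\<^sup>2"
      using consts_x \<beta> by (auto intro!: mult_left_mono power_mono)
    have nn: "0 \<le> \<alpha>x * \<rho>x\<^sup>2" "0 \<le> \<beta>y * \<rho>y\<^sup>2" using consts_x \<beta> by auto
    have "sqrt \<alpha>x * norm (x 0 - xh) = sqrt (\<alpha>x * (norm (x 0 - xh))\<^sup>2)" by (simp add: real_sqrt_mult)
    also have "\<dots> \<le> R" unfolding R_def using sq nn by (intro real_sqrt_le_mono) linarith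
    finally have 1: "sqrt \<alpha>x * norm (x 0 - xh) \<le> R" .
    have "max 0 (Dsq_y L xh yh (y 0)) \<le> (\<alpha>x * \<rho>x\<^sup>2 + \<beta>y * \<rho>y\<^sup>2) + E"
      using smooth_y[OF y_mem[of 0]] sq nn E0 by linarith
    then have "?Dy (y 0) \<le> sqrt ((\<alpha>x * \<rho>x\<^sup>2 + \<beta>y * \<rho>y\<^sup>2) + E)" unfolding D_y_def by simp
    also have "\<dots> \<le> R + sqrt E" unfolding R_def using nn E0 by (intro sqrt_add_le_add_sqrt) auto
    finally have "?Dy (y 0) \<le> B 0" unfolding B_def using sE sn n0 nW by simp
    moreover have "R \<le> 10 / 7 * B 0 + s" unfolding B_def power_0 mult_1 using R0 W0 s0 by argo
    ultimately show ?case using 1 by linarith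
  next
    case (Suc t)
    then show ?case using step[of t] dist_x[OF x_mem[of "Suc t"]] by linarith
  qed

  define m where "m = min \<alpha>x \<alpha>y"
  have m: "0 < m" "m \<le> \<alpha>x" "m \<le> \<alpha>y" unfolding m_def using consts_x consts_y by auto
  have bound: "norm ((x t, y t) - (xh, yh)) \<le> r ^ t * (sqrt 6 * R / sqrt m) + C * e" for t
  proof -
    let ?a = "norm (x t - xh)" and ?b = "norm (y t - yh)"
    have ha: "sqrt \<alpha>x * ?a \<le> 10 / 7 * B t + s" using inv by blast
    have hb: "sqrt \<alpha>y * ?b \<le> B t + s" using inv[of t] dist_y[OF y_mem[of t]] by linarith
    have sqm: "sqrt m * ?a \<le> sqrt \<alpha>x * ?a" "sqrt m * ?b \<le> sqrt \<alpha>y * ?b"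
      using m by (auto intro!: mult_right_mono)
    have "(sqrt m * norm ((x t, y t) - (xh, yh)))\<^sup>2 = (sqrt m * ?a)\<^sup>2 + (sqrt m * ?b)\<^sup>2"
      by (simp add: norm_Pair power_mult_distrib algebra_simps)
    also have "\<dots> \<le> (10 / 7 * B t + s)\<^sup>2 + (B t + s)\<^sup>2"
      using sqm ha hb m by (intro add_mono power_mono) auto
    also have "\<dots> \<le> (7 / 4 * B t + 3 / 2 * s)\<^sup>2"
    proof -
      have "(7 / 4 * B t + 3 / 2 * s)\<^sup>2 - ((10 / 7 * B t + s)\<^sup>2 + (B t + s)\<^sup>2)
          = 17 / 784 * (B t)\<^sup>2 + 11 / 28 * (B t * s) + 1 / 4 * s\<^sup>2"
        by (simp add: power2_eq_square field_simps)
      also have "\<dots> \<ge> 0" using B0[of t] s0 by (intro add_nonneg_nonneg mult_nonneg_nonneg) auto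
      finally show ?thesis by linarith
    qed
    finally have "sqrt m * norm ((x t, y t) - (xh, yh)) \<le> 7 / 4 * B t + 3 / 2 * s"
      by (rule power2_le_imp_le) (use B0[of t] s0 in auto)
    also have "\<dots> \<le> r ^ t * (sqrt 6 * R) + 39 / (1 - r) * (M * e)"
    proof -
      have "7 / 4 \<le> sqrt 6" by (rule real_le_rsqrt) (simp add: power2_eq_square)
      then have "7 / 4 * (r ^ t * R) \<le> sqrt 6 * (r ^ t * R)"
        using r0 R0 by (intro mult_right_mono) auto
      moreover have "3 / 2 * s \<le> 2 * (M * e) / (1 - r)"
      proof -
        have "(3 / 2 * s) * (1 - r) \<le> (3 / 2 * s) * 1" using s0 r0 by (intro mult_left_mono) auto
        then have "(3 / 2 * s) * (1 - r) \<le> 2 * (M * e)" using sM s0 by linarith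
        then show ?thesis using r_less by (simp add: pos_le_divide_eq)
      qed
      moreover have "7 / 4 * W + 2 * (M * e) / (1 - r) \<le> 39 / (1 - r) * (M * e)"
      proof -
        define Q where "Q = M * e / (1 - r)"
        have "0 \<le> Q" unfolding Q_def using sM s0 r_less by simp
        moreover have "W = 17 / 7 * (9 / 2) * Q" unfolding W_def n_def Q_def by simp
        moreover have "2 * (M * e) / (1 - r) = 2 * Q" "39 / (1 - r) * (M * e) = 39 * Q"
          unfolding Q_def by simp_all
        ultimately show ?thesis by simp
      qed
      moreover have "r ^ t * (sqrt 6 * R) = sqrt 6 * (r ^ t * R)" by simp
      ultimately show ?thesis unfolding B_def distrib_left by linarith
    qed
    finally have "norm ((x t, y t) - (xh, yh)) \<le> (r ^ t * (sqrt 6 * R) + 39 / (1 - r) * (M * e)) / sqrt m"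
      using m by (simp add: pos_le_divide_eq mult.commute)
    also have "\<dots> = r ^ t * (sqrt 6 * R / sqrt m) + C * e"
      unfolding C_eq m_def[symmetric] real_sqrt_divide M_def[symmetric]
      by (subst add_divide_distrib) simp
    finally show ?thesis .
  qed
  show ?thesis
    using bound unfolding R_def e_def m_def by (simp only: real_sqrt_mult) blast
qed

end
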